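(* Let $M=\begin{bmatrix}A & B\\ B^\top & C\end{bmatrix}\in\mathcal{S}^{k+n}$, where $A=(a_{i,j})\in\mathcal{S}^k$, $B=(b_{i,\alpha})\in\mathbb{R}^{k\times n}$ and $C\in\mathcal{S}^n$. Assume that (1) $a_{i,j}\le 0$ for all $i\neq j$; (2) $b_{i,\alpha}\le 0$ for all $i,\alpha$; (3) for each fixed $i$, the row $(b_{i,1},\dots,b_{i,n})$ is nondecreasing; (4) $C\in\mathcal{M}_n$. Then $M\in\mathcal{C}op_{k+n}$ if and only if $M\in\mathcal{SPN}_{k+n}$.
   Context: $\mathcal{S}^n$ is the set of real symmetric $n\times n$ matrices. $\mathcal{C}op_n\subseteq\mathcal{S}^n$ is the cone of copositive matrices ($x^\top A x\ge0$ for all entrywise nonnegative $x\in\mathbb{R}^n$). $\mathcal{SPN}_n\subseteq\mathcal{S}^n$ is the cone of matrices that are the sum of a symmetric positive semidefinite matrix and a symmetric entrywise nonnegative matrix. $\mathcal{M}_n=\{A=(a_{i,j})\in\mathcal{S}^n : a_{i,j}\le a_{k,\ell} \text{ whenever } i\le k,\ j\le \ell,\ i\neq j,\ k\neq \ell\}$. *)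

theory Defs
  imports Complex_Main "Jordan_Normal_Form.Matrix"
begin

text \<open>Indices are 0-based: an $n \times n$ matrix has entries \<open>A $$ (i, j)\<close> with \<open>i, j < n\<close>.
  All cones are sets of matrices whose dimension is an explicit natural number.\<close>

definition Sym :: "nat \<Rightarrow> real mat set" where
  "Sym n = {A \<in> carrier_mat n n. transpose_mat A = A}"

definition Cop :: "nat \<Rightarrow> real mat set" where
  "Cop n = {A \<in> Sym n. \<forall>x \<in> carrier_vec n. (\<forall>i<n. x $ i \<ge> 0) \<longrightarrow> x \<bullet> (A *\<^sub>v x) \<ge> 0}"

definition Sym_PSD :: "nat \<Rightarrow> real mat set" where
  "Sym_PSD n = {A \<in> Sym n. \<forall>x \<in> carrier_vec n. x \<bullet> (A *\<^sub>v x) \<ge> 0}"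

definition Sym_nonneg :: "nat \<Rightarrow> real mat set" where
  "Sym_nonneg n = {A \<in> Sym n. \<forall>i<n. \<forall>j<n. A $$ (i, j) \<ge> 0}"

definition SPN :: "nat \<Rightarrow> real mat set" where
  "SPN n = {P + N | P N. P \<in> Sym_PSD n \<and> N \<in> Sym_nonneg n}"

text \<open>Only off-diagonal entries are compared; diagonal entries are unconstrained.\<close>

definition Mono_mats :: "nat \<Rightarrow> real mat set" where
  "Mono_mats n = {A \<in> Sym n. \<forall>i<n. \<forall>j<n. \<forall>k<n. \<forall>l<n.
     i \<le> k \<and> j \<le> l \<and> i \<noteq> j \<and> k \<noteq> l \<longrightarrow> A $$ (i, j) \<le> A $$ (k, l)}"

end

theory Submission
  imports Defs
begin

text \<open>The direction from right to left is immediate. For the converse, the index set is shrunk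
  one index at a time by two reductions.

  If the off-diagonal entries of row \<open>v\<close> are all nonpositive, pass to the Schur complement
  \<open>a i j - a v i * a v j / a v v\<close> on the remaining indices. For given nonnegative values of the
  other variables, the quadratic form is minimised at a nonnegative value of the variable \<open>v\<close>, so
  the Schur complement of a copositive matrix is copositive (\<open>copositive_on_schur\<close>); if
  \<open>a v v = 0\<close>, copositivity makes the whole row vanish (\<open>copositive_on_zero_row\<close>). The given
  matrix and its Schur complement differ by a rank one positive semidefinite matrix, so an SPN
  decomposition of the Schur complement lifts (\<open>spn_on_of_schur\<close>). If instead the off-diagonal
  entries of row \<open>w\<close> are nonnegative, then so is the whole row, the diagonal of a copositive
  matrix being nonnegative; the row goes into the nonnegative summand and \<open>w\<close> is deleted
  (\<open>spn_on_of_nonneg_row\<close>).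

  One of the reductions always applies. An index of the block \<open>A\<close> has nonpositive off-diagonal
  entries in its row. When only indices of \<open>C\<close> remain, let \<open>v\<close> be the least and \<open>w\<close> the
  greatest of them: if \<open>v = w\<close> or \<open>a v w \<le> 0\<close>, then by monotonicity the off-diagonal entries of
  row \<open>v\<close> are nonpositive; otherwise \<open>0 < a v w \<le> a i w\<close> for all \<open>i \<noteq> w\<close>, and row \<open>w\<close> is
  nonnegative. The hypotheses survive the Schur complement because \<open>a v i * a v j\<close> is a product of
  two nonpositive factors, hence nonnegative, and because each factor is nondecreasing along the
  indices of \<open>C\<close>, so that the product is nonincreasing there
  (\<open>sign_monotone_on_schur\<close>).\<close>

section \<open>Quadratic forms on a finite index set\<close>

text \<open>Symmetric matrices are represented by functions of two indices, considered only on a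
  finite set \<open>I\<close> of indices, so that passing to a principal submatrix means shrinking \<open>I\<close>.\<close>

definition quad_on :: "'i set \<Rightarrow> ('i \<Rightarrow> 'i \<Rightarrow> real) \<Rightarrow> ('i \<Rightarrow> real) \<Rightarrow> real" where
  "quad_on I a x = (\<Sum>i\<in>I. \<Sum>j\<in>I. a i j * x i * x j)"

definition symmetric_on :: "'i set \<Rightarrow> ('i \<Rightarrow> 'i \<Rightarrow> real) \<Rightarrow> bool" where
  "symmetric_on I a \<longleftrightarrow> (\<forall>i\<in>I. \<forall>j\<in>I. a i j = a j i)"

text \<open>Copositivity of the principal submatrix indexed by \<open>I\<close>.\<close>

definition copositive_on :: "'i set \<Rightarrow> ('i \<Rightarrow> 'i \<Rightarrow> real) \<Rightarrow> bool" where
  "copositive_on I a \<longleftrightarrow> (\<forall>x. (\<forall>i\<in>I. 0 \<le> x i) \<longrightarrow> 0 \<le> quad_on I a x)"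

text \<open>The principal submatrix indexed by \<open>I\<close> dominates entrywise a symmetric positive semidefinite
  matrix \<open>p\<close>; for symmetric \<open>a\<close> the difference is the symmetric nonnegative summand.\<close>

definition spn_on :: "'i set \<Rightarrow> ('i \<Rightarrow> 'i \<Rightarrow> real) \<Rightarrow> bool" where
  "spn_on I a \<longleftrightarrow> (\<exists>p. symmetric_on I p \<and> (\<forall>x. 0 \<le> quad_on I p x) \<and> (\<forall>i\<in>I. \<forall>j\<in>I. p i j \<le> a i j))"

text \<open>For \<open>a v v = 0\<close> the quotient is \<open>0\<close>, so that the matrix is left unchanged.\<close>

definition schur :: "'i \<Rightarrow> ('i \<Rightarrow> 'i \<Rightarrow> real) \<Rightarrow> 'i \<Rightarrow> 'i \<Rightarrow> real" where
  "schur v a i j = a i j - a v i * a v j / a v v"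

lemma quad_on_cong:
  assumes "\<And>i j. i \<in> I \<Longrightarrow> j \<in> I \<Longrightarrow> a i j = b i j" "\<And>i. i \<in> I \<Longrightarrow> x i = y i"
  shows "quad_on I a x = quad_on I b y"
  unfolding quad_on_def by (intro sum.cong refl) (simp add: assms)

lemma quad_on_insert:
  assumes "finite J" "v \<notin> J" "symmetric_on (insert v J) a"
  shows "quad_on (insert v J) a x
    = a v v * (x v)\<^sup>2 + 2 * x v * (\<Sum>j\<in>J. a v j * x j) + quad_on J a x"
proof -
  have "a i v = a v i" if "i \<in> J" for i
    using assms(3) that unfolding symmetric_on_def by blast
  then have "(\<Sum>i\<in>J. a i v * x i * x v) = x v * (\<Sum>j\<in>J. a v j * x j)"
    unfolding sum_distrib_left by (intro sum.cong refl) simp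
  moreover have "(\<Sum>j\<in>J. a v j * x v * x j) = x v * (\<Sum>j\<in>J. a v j * x j)"
    unfolding sum_distrib_left by (intro sum.cong refl) simp
  ultimately show ?thesis
    using assms(1,2) by (simp add: quad_on_def sum.distrib power2_eq_square)
qed

lemma quad_on_schur:
  "quad_on J (schur v a) x = quad_on J a x - (\<Sum>j\<in>J. a v j * x j)\<^sup>2 / a v v"
proof -
  have "(\<Sum>j\<in>J. a v j * x j)\<^sup>2 / a v v = (\<Sum>i\<in>J. \<Sum>j\<in>J. a v i * a v j / a v v * x i * x j)"
    by (simp add: power2_eq_square sum_product sum_divide_distrib mult_ac)
  then show ?thesis
    by (simp add: quad_on_def schur_def left_diff_distrib sum_subtractf)
qed

lemma symmetric_on_subset: "symmetric_on I a \<Longrightarrow> J \<subseteq> I \<Longrightarrow> symmetric_on J a"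
  by (auto simp: symmetric_on_def)

lemma symmetric_on_schur: "symmetric_on I a \<Longrightarrow> symmetric_on I (schur v a)"
  by (simp add: symmetric_on_def schur_def mult.commute)

section \<open>Deleting an index from a copositive matrix\<close>

lemma copositive_on_insertD:
  assumes "finite J" "v \<notin> J" "symmetric_on (insert v J) a" "copositive_on (insert v J) a"
    and "0 \<le> t" "\<forall>j\<in>J. 0 \<le> x j"
  shows "0 \<le> a v v * t\<^sup>2 + 2 * t * (\<Sum>j\<in>J. a v j * x j) + quad_on J a x"
proof -
  have "0 \<le> quad_on (insert v J) a (x(v := t))"
    using assms(4-6) by (simp add: copositive_on_def)
  also have "\<dots> = a v v * t\<^sup>2 + 2 * t * (\<Sum>j\<in>J. a v j * (x(v := t)) j) + quad_on J a (x(v := t))"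
    using quad_on_insert[OF assms(1-3)] by simp
  also have "(\<Sum>j\<in>J. a v j * (x(v := t)) j) = (\<Sum>j\<in>J. a v j * x j)"
    using assms(2) by (intro sum.cong) auto
  also have "quad_on J a (x(v := t)) = quad_on J a x"
    using assms(2) by (intro quad_on_cong) auto
  finally show ?thesis .
qed

lemma copositive_on_diag:
  assumes "finite J" "v \<notin> J" "symmetric_on (insert v J) a" "copositive_on (insert v J) a"
  shows "0 \<le> a v v"
  using copositive_on_insertD[OF assms, of 1 "\<lambda>_. 0"] by (simp add: quad_on_def)

lemma copositive_on_subset_insert:
  assumes "finite J" "v \<notin> J" "symmetric_on (insert v J) a" "copositive_on (insert v J) a"
  shows "copositive_on J a"
  using copositive_on_insertD[OF assms, of 0] by (simp add: copositive_on_def)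

lemma copositive_on_zero_row:
  assumes "finite J" "v \<notin> J" "symmetric_on (insert v J) a" "copositive_on (insert v J) a"
    and "\<forall>j\<in>J. a v j \<le> 0" "a v v = 0"
  shows "\<forall>j\<in>J. a v j = 0"
proof -
  define s where "s = (\<Sum>j\<in>J. a v j)"
  define q where "q = quad_on J a (\<lambda>_. 1)"
  have le: "s \<le> 0"
    unfolding s_def using assms(5) by (intro sum_nonpos) auto
  have ineq: "0 \<le> 2 * t * s + q" if "0 \<le> t" for t
    using copositive_on_insertD[OF assms(1-4) that, of "\<lambda>_. 1"] assms(6)
    by (simp add: s_def q_def)
  have "s = 0"
  proof (rule ccontr)
    assume "s \<noteq> 0"
    with le have neg: "s < 0" by simp
    \<comment> \<open>The form is affine in \<open>t\<close> with negative slope \<open>2 * s\<close>.\<close>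
    define t where "t = (\<bar>q\<bar> + 1) / (- s)"
    have "t * s = - (\<bar>q\<bar> + 1)" "0 \<le> t"
      using neg by (auto simp: t_def field_simps)
    with ineq[of t] show False by simp
  qed
  then have "(\<Sum>j\<in>J. - a v j) = 0"
    by (simp add: s_def sum_negf)
  then show ?thesis
    using assms(1,5) by (subst (asm) sum_nonneg_eq_0_iff) auto
qed

lemma copositive_on_schur:
  assumes "finite J" "v \<notin> J" "symmetric_on (insert v J) a" "copositive_on (insert v J) a"
    and row: "\<forall>j\<in>J. a v j \<le> 0"
  shows "copositive_on J (schur v a)"
  unfolding copositive_on_def
proof (intro allI impI)
  fix x :: "'a \<Rightarrow> real" assume x: "\<forall>i\<in>J. 0 \<le> x i"
  define s where "s = (\<Sum>j\<in>J. a v j * x j)"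
  have diag: "0 \<le> a v v" using copositive_on_diag[OF assms(1-4)] .
  have "s \<le> 0"
    unfolding s_def using row x by (intro sum_nonpos) (simp add: mult_nonpos_nonneg)
  with diag have t: "0 \<le> - s / a v v"
    by (simp add: divide_nonpos_nonneg)
  \<comment> \<open>The minimiser of the form in the variable \<open>v\<close>.\<close>
  have "0 \<le> a v v * (- s / a v v)\<^sup>2 + 2 * (- s / a v v) * s + quad_on J a x"
    using copositive_on_insertD[OF assms(1-4) t x] by (simp add: s_def)
  also have "a v v * (- s / a v v)\<^sup>2 + 2 * (- s / a v v) * s = - (s\<^sup>2 / a v v)"
    by (cases "a v v = 0") (simp_all add: field_simps power2_eq_square)
  finally show "0 \<le> quad_on J (schur v a) x"
    by (simp add: quad_on_schur s_def)
qed

section \<open>Lifting decompositions to one more index\<close>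

lemma spn_on_of_schur:
  assumes "finite J" "v \<notin> J" and sym: "symmetric_on (insert v J) a"
    and "0 \<le> a v v" and zero: "a v v = 0 \<Longrightarrow> \<forall>j\<in>J. a v j = 0"
    and "spn_on J (schur v a)"
  shows "spn_on (insert v J) a"
proof -
  obtain p where p: "symmetric_on J p" "\<And>x. 0 \<le> quad_on J p x"
    and le: "\<And>i j. i \<in> J \<Longrightarrow> j \<in> J \<Longrightarrow> p i j \<le> schur v a i j"
    using assms(6) by (auto simp: spn_on_def)
  \<comment> \<open>The matrix whose row \<open>v\<close> is that of \<open>a\<close> and whose Schur complement is \<open>p\<close>.\<close>
  define r where "r i j = (if i = v \<or> j = v then a i j else p i j + a v i * a v j / a v v)" for i j
  have r_v: "r v j = a v j" for j by (simp add: r_def)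
  have r_sym: "symmetric_on (insert v J) r"
    unfolding symmetric_on_def
  proof (intro ballI)
    fix i j assume *: "i \<in> insert v J" "j \<in> insert v J"
    then have "a i j = a j i" "i \<noteq> v \<Longrightarrow> j \<noteq> v \<Longrightarrow> p i j = p j i"
      using sym p(1) unfolding symmetric_on_def by blast+
    then show "r i j = r j i"
      by (cases "i = v"; cases "j = v") (simp_all add: r_def mult.commute)
  qed
  have r_schur: "schur v r i j = p i j" if "i \<in> J" "j \<in> J" for i j
    using that assms(2) by (auto simp: schur_def r_def)
  have "0 \<le> quad_on (insert v J) r x" for x
  proof -
    define s where "s = (\<Sum>j\<in>J. a v j * x j)"
    have s0: "s = 0" if "a v v = 0"
      using zero[OF that] by (simp add: s_def)
    have "quad_on J p x = quad_on J (schur v r) x"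
      by (intro quad_on_cong) (simp_all add: r_schur)
    then have "quad_on J r x = quad_on J p x + s\<^sup>2 / a v v"
      by (simp add: quad_on_schur r_v s_def)
    then have "quad_on (insert v J) r x
        = a v v * (x v)\<^sup>2 + 2 * x v * s + s\<^sup>2 / a v v + quad_on J p x"
      using quad_on_insert[OF assms(1,2) r_sym, of x] by (simp add: r_v s_def)
    also have "a v v * (x v)\<^sup>2 + 2 * x v * s + s\<^sup>2 / a v v = (a v v * x v + s)\<^sup>2 / a v v"
      using s0 by (cases "a v v = 0") (simp_all add: field_simps power2_eq_square)
    finally show ?thesis using assms(4) p(2)[of x] by simp
  qed
  moreover have "r i j \<le> a i j" if "i \<in> insert v J" "j \<in> insert v J" for i j
    using that le[of i j] by (auto simp: r_def schur_def)
  ultimately show ?thesis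
    using r_sym unfolding spn_on_def by blast
qed

lemma spn_on_of_nonneg_row:
  assumes "finite J" "w \<notin> J" and sym: "symmetric_on (insert w J) a"
    and row: "\<forall>i\<in>insert w J. 0 \<le> a w i" and "spn_on J a"
  shows "spn_on (insert w J) a"
proof -
  obtain p where p: "symmetric_on J p" "\<And>x. 0 \<le> quad_on J p x"
    and le: "\<And>i j. i \<in> J \<Longrightarrow> j \<in> J \<Longrightarrow> p i j \<le> a i j"
    using assms(5) by (auto simp: spn_on_def)
  define r where "r i j = (if i = w \<or> j = w then 0 else p i j)" for i j
  have r_sym: "symmetric_on (insert w J) r"
    using p(1) by (auto simp: symmetric_on_def r_def)
  have "quad_on J r x = quad_on J p x" for x
    using assms(2) by (intro quad_on_cong) (auto simp: r_def)
  then have "0 \<le> quad_on (insert w J) r x" for x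
    using quad_on_insert[OF assms(1,2) r_sym, of x] p(2)[of x] by (simp add: r_def)
  moreover have "r i j \<le> a i j" if "i \<in> insert w J" "j \<in> insert w J" for i j
  proof -
    have "a i w = a w i" using sym that(1) by (auto simp: symmetric_on_def)
    then show ?thesis using that le[of i j] row by (auto simp: r_def)
  qed
  ultimately show ?thesis
    using r_sym unfolding spn_on_def by blast
qed

section \<open>The class of matrices\<close>

text \<open>The sign and monotonicity hypotheses for the principal submatrix indexed by \<open>I\<close>, where the
  indices below \<open>k\<close> belong to the block \<open>A\<close> and the others to \<open>C\<close>.\<close>

definition sign_monotone_on :: "'i::linorder \<Rightarrow> 'i set \<Rightarrow> ('i \<Rightarrow> 'i \<Rightarrow> real) \<Rightarrow> bool" where
  "sign_monotone_on k I a \<longleftrightarrow> symmetric_on I a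
    \<and> (\<forall>i\<in>I. \<forall>j\<in>I. i < k \<longrightarrow> i \<noteq> j \<longrightarrow> a i j \<le> 0)
    \<and> (\<forall>i\<in>I. \<forall>j\<in>I. \<forall>l\<in>I. i < k \<longrightarrow> k \<le> j \<longrightarrow> j \<le> l \<longrightarrow> a i j \<le> a i l)
    \<and> (\<forall>i\<in>I. \<forall>j\<in>I. \<forall>m\<in>I. \<forall>l\<in>I. k \<le> i \<longrightarrow> k \<le> j \<longrightarrow> i \<le> m \<longrightarrow> j \<le> l \<longrightarrow> i \<noteq> j \<longrightarrow> m \<noteq> l
        \<longrightarrow> a i j \<le> a m l)"

lemma sign_monotone_on_subset:
  "sign_monotone_on k I a \<Longrightarrow> J \<subseteq> I \<Longrightarrow> sign_monotone_on k J a"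
  unfolding sign_monotone_on_def symmetric_on_def by (meson subsetD)

lemma sign_monotone_on_schur:
  assumes J: "sign_monotone_on k J a" and "0 \<le> a v v"
    and row: "\<And>j. j \<in> J \<Longrightarrow> a v j \<le> 0"
    and mono: "\<And>j l. j \<in> J \<Longrightarrow> l \<in> J \<Longrightarrow> k \<le> j \<Longrightarrow> j \<le> l \<Longrightarrow> a v j \<le> a v l"
  shows "sign_monotone_on k J (schur v a)"
  unfolding sign_monotone_on_def
proof (intro conjI ballI impI)
  show "symmetric_on J (schur v a)"
    using J by (simp add: sign_monotone_on_def symmetric_on_schur)
next
  fix i j assume "i \<in> J" "j \<in> J" "i < k" "i \<noteq> j"
  moreover from this have "a i j \<le> 0"
    using J by (simp add: sign_monotone_on_def)
  moreover have "0 \<le> a v i * a v j / a v v"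
    using \<open>i \<in> J\<close> \<open>j \<in> J\<close> row assms(2) by (simp add: mult_nonpos_nonpos)
  ultimately show "schur v a i j \<le> 0" by (simp add: schur_def)
next
  fix i j l assume *: "i \<in> J" "j \<in> J" "l \<in> J" "i < k" "k \<le> j" "j \<le> l"
  then have "a i j \<le> a i l"
    using J by (simp add: sign_monotone_on_def)
  moreover have "a v i * a v l / a v v \<le> a v i * a v j / a v v"
    using * row mono assms(2) by (intro divide_right_mono mult_left_mono_neg) auto
  ultimately show "schur v a i j \<le> schur v a i l" by (simp add: schur_def)
next
  fix i j m l
  assume *: "i \<in> J" "j \<in> J" "m \<in> J" "l \<in> J" "k \<le> i" "k \<le> j" "i \<le> m" "j \<le> l" "i \<noteq> j" "m \<noteq> l"
  then have "a i j \<le> a m l"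
    using J by (simp add: sign_monotone_on_def)
  moreover have "(- a v m) * (- a v l) \<le> (- a v i) * (- a v j)"
    by (intro mult_mono) (use * row mono in auto)
  then have "a v m * a v l / a v v \<le> a v i * a v j / a v v"
    using assms(2) by (simp add: divide_right_mono)
  ultimately show "schur v a i j \<le> schur v a m l" by (simp add: schur_def)
qed

lemma sign_monotone_on_nonneg_row:
  assumes I: "finite I" "v \<in> I" "sign_monotone_on k I a"
    and ge: "\<forall>i\<in>I. k \<le> i" and v: "v = Min I" and w: "w = Max I"
    and "v \<noteq> w" "0 \<le> a v w"
  shows "\<forall>j\<in>I - {w}. 0 \<le> a w j"
proof
  fix j assume j: "j \<in> I - {w}"
  have "w \<in> I" using Max_in[OF I(1)] I(2) w by auto
  have "a v w \<le> a j w"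
    using I(3) ge j \<open>v \<in> I\<close> \<open>w \<in> I\<close> \<open>v \<noteq> w\<close> Min_le[OF I(1), of j] v
    by (auto simp: sign_monotone_on_def)
  also have "a j w = a w j"
    using I(3) j \<open>w \<in> I\<close> by (auto simp: sign_monotone_on_def symmetric_on_def)
  finally show "0 \<le> a w j" using \<open>0 \<le> a v w\<close> by simp
qed

theorem spn_on_of_copositive_on:
  assumes "finite I" "sign_monotone_on k I a" "copositive_on I a"
  shows "spn_on I a"
  using assms
proof (induction "card I" arbitrary: I a rule: less_induct)
  case less
  note fin = \<open>finite I\<close> and cls = \<open>sign_monotone_on k I a\<close> and cop = \<open>copositive_on I a\<close>
  have sym: "symmetric_on I a" using cls by (simp add: sign_monotone_on_def)
  have eliminate: ?case
    if v: "v \<in> I" and row: "\<And>j. j \<in> I - {v} \<Longrightarrow> a v j \<le> 0"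
      and mono: "\<And>j l. j \<in> I - {v} \<Longrightarrow> l \<in> I - {v} \<Longrightarrow> k \<le> j \<Longrightarrow> j \<le> l \<Longrightarrow> a v j \<le> a v l"
    for v
  proof -
    define J where "J = I - {v}"
    have I: "I = insert v J" "v \<notin> J" "finite J" "card J < card I"
      using fin v card_Diff1_less[OF fin v] unfolding J_def by blast+
    note J = I(3) I(2) sym[unfolded I(1)] cop[unfolded I(1)]
    have row': "\<forall>j\<in>J. a v j \<le> 0" using row by (simp add: J_def)
    have diag: "0 \<le> a v v" using copositive_on_diag[OF J] .
    have "sign_monotone_on k J (schur v a)"
      using sign_monotone_on_subset[OF cls, of J] diag row mono
      by (intro sign_monotone_on_schur) (auto simp: J_def)
    then have "spn_on J (schur v a)"
      using less.hyps I copositive_on_schur[OF J row'] by blast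
    then show ?thesis
      using spn_on_of_schur[OF J(1-3) diag] copositive_on_zero_row[OF J row'] I(1) by blast
  qed
  consider "I = {}" | v where "v \<in> I" "v < k" | "I \<noteq> {}" "\<forall>i\<in>I. k \<le> i"
    by (meson equals0I not_le)
  then show ?case
  proof cases
    case 1
    then show ?thesis by (auto simp: spn_on_def symmetric_on_def quad_on_def)
  next
    case (2 v)
    show ?thesis
      by (rule eliminate[OF \<open>v \<in> I\<close>]) (use 2 cls in \<open>auto simp: sign_monotone_on_def\<close>)
  next
    case 3
    define v w where "v = Min I" and "w = Max I"
    have vw: "v \<in> I" "w \<in> I" "\<And>i. i \<in> I \<Longrightarrow> v \<le> i" "\<And>i. i \<in> I \<Longrightarrow> i \<le> w"
      using fin 3(1) by (auto simp: v_def w_def)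
    show ?thesis
    proof (cases "v = w \<or> a v w \<le> 0")
      case True
      show ?thesis
      proof (rule eliminate[OF vw(1)])
        fix j assume j: "j \<in> I - {v}"
        with vw have "v \<noteq> w" by (metis DiffE antisym singletonI)
        then have "a v j \<le> a v w"
          using cls 3(2) vw j by (auto simp: sign_monotone_on_def)
        with True \<open>v \<noteq> w\<close> show "a v j \<le> 0" by simp
      next
        fix j l assume "j \<in> I - {v}" "l \<in> I - {v}" "j \<le> l"
        then show "a v j \<le> a v l"
          using cls 3(2) vw by (auto simp: sign_monotone_on_def)
      qed
    next
      case False
      define J where "J = I - {w}"
      have I: "I = insert w J" "w \<notin> J" "finite J" "card J < card I"
        using fin vw(2) card_Diff1_less[OF fin vw(2)] unfolding J_def by blast+
      note J = I(3) I(2) sym[unfolded I(1)] cop[unfolded I(1)]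
      have "spn_on J a"
        using less.hyps I copositive_on_subset_insert[OF J] sign_monotone_on_subset[OF cls]
        by blast
      moreover have "\<forall>i\<in>insert w J. 0 \<le> a w i"
        using sign_monotone_on_nonneg_row[OF fin vw(1) cls 3(2) v_def w_def] False
          copositive_on_diag[OF J] by (auto simp: J_def)
      ultimately show ?thesis
        using spn_on_of_nonneg_row[OF J(1-3)] I(1) by simp
    qed
  qed
qed

section \<open>Translation to matrices\<close>

lemma scalar_prod_mult_mat_vec_eq_quad_on:
  assumes "A \<in> carrier_mat m m" "x \<in> carrier_vec m"
  shows "x \<bullet> (A *\<^sub>v x) = quad_on {..<m} (\<lambda>i j. A $$ (i, j)) (\<lambda>i. x $ i)"
  using assms
  by (auto simp: scalar_prod_def quad_on_def sum_distrib_left lessThan_atLeast0 mult_ac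
      intro!: sum.cong)

lemma Sym_iff_symmetric_on:
  assumes "A \<in> carrier_mat m m"
  shows "A \<in> Sym m \<longleftrightarrow> symmetric_on {..<m} (\<lambda>i j. A $$ (i, j))"
  using assms by (auto simp: Sym_def symmetric_on_def mat_eq_iff)

lemma copositive_on_of_Cop:
  assumes "A \<in> Cop m"
  shows "copositive_on {..<m} (\<lambda>i j. A $$ (i, j))"
  unfolding copositive_on_def
proof (intro allI impI)
  fix x :: "nat \<Rightarrow> real" assume x: "\<forall>i\<in>{..<m}. 0 \<le> x i"
  have A: "A \<in> carrier_mat m m" using assms by (simp add: Cop_def Sym_def)
  have "0 \<le> vec m x \<bullet> (A *\<^sub>v vec m x)"
    using assms x by (simp add: Cop_def)
  also have "\<dots> = quad_on {..<m} (\<lambda>i j. A $$ (i, j)) x"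
    by (subst scalar_prod_mult_mat_vec_eq_quad_on[OF A vec_carrier])
      (intro quad_on_cong, simp_all)
  finally show "0 \<le> quad_on {..<m} (\<lambda>i j. A $$ (i, j)) x" .
qed

lemma SPN_of_spn_on:
  assumes "A \<in> Sym m" "spn_on {..<m} (\<lambda>i j. A $$ (i, j))"
  shows "A \<in> SPN m"
proof -
  have A: "A \<in> carrier_mat m m" and A_sym: "symmetric_on {..<m} (\<lambda>i j. A $$ (i, j))"
    using assms(1) Sym_iff_symmetric_on by (auto simp: Sym_def)
  obtain p where p: "symmetric_on {..<m} p" "\<And>x. 0 \<le> quad_on {..<m} p x"
    and le: "\<And>i j. i < m \<Longrightarrow> j < m \<Longrightarrow> p i j \<le> A $$ (i, j)"
    using assms(2) by (auto simp: spn_on_def)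
  define P where "P = mat m m (\<lambda>(i, j). p i j)"
  have P: "P \<in> carrier_mat m m" by (simp add: P_def)
  have "P \<in> Sym m"
    using p(1) unfolding Sym_iff_symmetric_on[OF P] by (simp add: symmetric_on_def P_def)
  moreover have "0 \<le> x \<bullet> (P *\<^sub>v x)" if "x \<in> carrier_vec m" for x
  proof -
    have "x \<bullet> (P *\<^sub>v x) = quad_on {..<m} p (\<lambda>i. x $ i)"
      unfolding scalar_prod_mult_mat_vec_eq_quad_on[OF P that]
      by (intro quad_on_cong) (simp_all add: P_def)
    with p(2) show ?thesis by simp
  qed
  ultimately have "P \<in> Sym_PSD m" by (simp add: Sym_PSD_def)
  moreover have "A - P \<in> Sym_nonneg m"
  proof -
    have "A - P \<in> carrier_mat m m" using P by (rule minus_carrier_mat)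
    then have "A - P \<in> Sym m"
      using A P A_sym p(1) by (subst Sym_iff_symmetric_on) (simp_all add: symmetric_on_def P_def)
    then show ?thesis
      using A P le by (simp add: Sym_nonneg_def P_def)
  qed
  moreover have "A = P + (A - P)"
    using A P by (intro eq_matI) auto
  ultimately show ?thesis unfolding SPN_def by blast
qed

lemma SPN_subset_Cop: "SPN m \<subseteq> Cop m"
proof
  fix A assume "A \<in> SPN m"
  then obtain P N where A: "A = P + N" and P: "P \<in> Sym_PSD m" and N: "N \<in> Sym_nonneg m"
    by (auto simp: SPN_def)
  have P': "P \<in> carrier_mat m m" "transpose_mat P = P"
    and N': "N \<in> carrier_mat m m" "transpose_mat N = N"
    using P N by (auto simp: Sym_PSD_def Sym_nonneg_def Sym_def)
  have "A \<in> Sym m"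
    using P' N' by (simp add: A Sym_def transpose_add)
  moreover have "0 \<le> x \<bullet> (A *\<^sub>v x)" if x: "x \<in> carrier_vec m" "\<forall>i<m. 0 \<le> x $ i" for x
  proof -
    have "0 \<le> x \<bullet> (N *\<^sub>v x)"
      unfolding scalar_prod_mult_mat_vec_eq_quad_on[OF N'(1) x(1)] quad_on_def
      using N x(2) by (intro sum_nonneg mult_nonneg_nonneg) (auto simp: Sym_nonneg_def)
    moreover have "0 \<le> x \<bullet> (P *\<^sub>v x)" using P x(1) by (simp add: Sym_PSD_def)
    moreover have "x \<bullet> (A *\<^sub>v x) = x \<bullet> (P *\<^sub>v x) + x \<bullet> (N *\<^sub>v x)"
      unfolding A using P'(1) N'(1) x(1)
      by (simp add: add_mult_distrib_mat_vec[of P m m N x] scalar_prod_add_distrib[of x m])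
    ultimately show ?thesis by simp
  qed
  ultimately show "A \<in> Cop m" by (simp add: Cop_def)
qed

theorem corollary3p10:
  fixes k n :: nat and A B C M :: "real mat"
  assumes M_def: "M = four_block_mat A B (transpose_mat B) C"
    and M: "M \<in> Sym (k + n)"
    and A: "A \<in> Sym k"
    and B: "B \<in> carrier_mat k n"
    and C: "C \<in> Sym n"
    and A_off: "\<And>i j. i < k \<Longrightarrow> j < k \<Longrightarrow> i \<noteq> j \<Longrightarrow> A $$ (i, j) \<le> 0"
    and B_nonpos: "\<And>i \<alpha>. i < k \<Longrightarrow> \<alpha> < n \<Longrightarrow> B $$ (i, \<alpha>) \<le> 0"
    and B_mono: "\<And>i \<alpha> \<beta>. i < k \<Longrightarrow> \<alpha> \<le> \<beta> \<Longrightarrow> \<beta> < n \<Longrightarrow> B $$ (i, \<alpha>) \<le> B $$ (i, \<beta>)"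
    and C_mono: "C \<in> Mono_mats n"
  shows "M \<in> Cop (k + n) \<longleftrightarrow> M \<in> SPN (k + n)"
proof
  assume "M \<in> SPN (k + n)"
  then show "M \<in> Cop (k + n)" using SPN_subset_Cop by blast
next
  assume cop: "M \<in> Cop (k + n)"
  let ?a = "\<lambda>i j. M $$ (i, j)" and ?I = "{..<k + n}"
  have dims: "A \<in> carrier_mat k k" "C \<in> carrier_mat n n" "M \<in> carrier_mat (k + n) (k + n)"
    using A C M by (auto simp: Sym_def)
  have block_A: "?a i j = A $$ (i, j)" if "i < k" "j < k" for i j
    using that dims B by (simp add: M_def)
  have block_B: "?a i j = B $$ (i, j - k)" if "i < k" "k \<le> j" "j < k + n" for i j
    using that dims B by (simp add: M_def)
  have block_C: "?a i j = C $$ (i - k, j - k)" if "k \<le> i" "i < k + n" "k \<le> j" "j < k + n" for i j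
    using that dims B by (simp add: M_def)
  have "sign_monotone_on k ?I ?a"
    unfolding sign_monotone_on_def
  proof (intro conjI ballI impI)
    show "symmetric_on ?I ?a" using M Sym_iff_symmetric_on dims(3) by blast
  next
    fix i j assume "i \<in> ?I" "j \<in> ?I" "i < k" "i \<noteq> j"
    then show "?a i j \<le> 0"
      using A_off B_nonpos by (cases "j < k") (auto simp: block_A block_B)
  next
    fix i j l assume "i \<in> ?I" "j \<in> ?I" "l \<in> ?I" "i < k" "k \<le> j" "j \<le> l"
    then show "?a i j \<le> ?a i l" using B_mono by (simp add: block_B)
  next
    fix i j m l
    assume *: "i \<in> ?I" "j \<in> ?I" "m \<in> ?I" "l \<in> ?I" "k \<le> i" "k \<le> j" "i \<le> m" "j \<le> l"
      "i \<noteq> j" "m \<noteq> l"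
    then have "i - k < n" "j - k < n" "m - k < n" "l - k < n" "i - k \<le> m - k" "j - k \<le> l - k"
      "i - k \<noteq> j - k" "m - k \<noteq> l - k" by auto
    then have "C $$ (i - k, j - k) \<le> C $$ (m - k, l - k)"
      using C_mono unfolding Mono_mats_def by blast
    then show "?a i j \<le> ?a m l" using * by (simp add: block_C)
  qed
  then have "spn_on ?I ?a"
    using spn_on_of_copositive_on copositive_on_of_Cop[OF cop] by blast
  then show "M \<in> SPN (k + n)" by (rule SPN_of_spn_on[OF M])
qed

end
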